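(* Let $\alpha>0$, let $r\ge 0$ be an integer, and let $X$ be a Poisson random variable with parameter $\alpha$, i.e. $P\{X=i\}=e^{-\alpha}\frac{\alpha^i}{i!}$ for $i=0,1,2,\dots$. Then for every integer $n\ge 0$, \[ E\big[\langle X+2r\rangle_{n}\big]=B_{n,r}^{L}(\alpha). \]
   Context: For a nonnegative integer $r$ and integers $0\le k\le n$, the $r$-Lah number $L_r(n,k)$ is the number of partitions of a set with $n+r$ elements into $k+r$ non-empty linearly ordered subsets such that $r$ distinguished elements lie in distinct subsets; equivalently $L_r(n,k)=\frac{n!}{k!}\binom{n+2r-1}{k+2r-1}$, with exponential generating function $\sum_{n\ge k}L_r(n,k)\frac{t^n}{n!}=\frac{1}{k!}\left(\frac{1}{1-t}-1\right)^k\left(\frac{1}{1-t}\right)^{2r}$. The $r$-extended Lah-Bell polynomials are $B^L_{n,r}(x)=\sum_{k=0}^n L_r(n,k)x^k$. The rising factorial is $\langle x\rangle_0=1$, $\langle x\rangle_n=x(x+1)\cdots(x+n-1)$ for $n\ge1$. *)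

theory Defs
  imports "HOL-Probability.Probability" "HOL-Library.Disjoint_Sets"
begin

text \<open>
  Partitions of \<open>A\<close> into \<open>m\<close> non-empty linearly ordered blocks such that the elements of \<open>D\<close>
  lie in distinct blocks. A linearly ordered finite block is encoded as a duplicate-free list, and
  \<open>inj_on set P\<close> excludes that the same block occurs with two different orders. For finite
  \<open>A\<close> every such \<open>P\<close> is finite, so \<open>card P = m\<close> is meaningful also for \<open>m = 0\<close>.
\<close>

definition ordered_partitions :: "'a set \<Rightarrow> 'a set \<Rightarrow> nat \<Rightarrow> 'a list set set" where
  "ordered_partitions A D m =
     {P. (\<forall>xs\<in>P. distinct xs) \<and> inj_on set P \<and> partition_on A (set ` P) \<and> card P = m \<and>
         (\<forall>xs\<in>P. card (set xs \<inter> D) \<le> 1)}"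

definition r_Lah :: "nat \<Rightarrow> nat \<Rightarrow> nat \<Rightarrow> nat" where
  "r_Lah r n k = card (ordered_partitions {..<n + r} {..<r} (k + r))"

definition r_Lah_Bell :: "nat \<Rightarrow> nat \<Rightarrow> real \<Rightarrow> real" where
  "r_Lah_Bell r n x = (\<Sum>k=0..n. real (r_Lah r n k) * x ^ k)"

end

theory Submission
  imports Defs
begin

text \<open>
  Removing the largest element of an ordered partition either deletes a singleton block or shortens
  a block, which gives \<open>L\<^sub>r(n+1,k) = L\<^sub>r(n,k-1) + (n+k+2r) L\<^sub>r(n,k)\<close>. The same recurrence governs the
  coefficients of \<open>\<langle>x+2r\<rangle>\<^sub>n\<close> in the basis of falling factorials \<open>(x)\<^sub>k\<close>, because
  \<open>(x)\<^sub>k (x+2r+n) = (x)\<^sub>k\<^sub>+\<^sub>1 + (n+k+2r) (x)\<^sub>k\<close>. Taking expectations, the claim follows since the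
  \<open>k\<close>-th factorial moment of a Poisson variable is \<open>\<alpha>\<^sup>k\<close>.
\<close>

section \<open>Counting ordered partitions\<close>

text \<open>Two different non-empty lists with the same set of elements meet, so once
  \<open>[]\<close> is excluded, injectivity of \<open>set\<close> and disjointness of the blocks
  merge into one condition on pairs of lists. If \<open>[] \<in> P\<close>, both sides are
  false.\<close>

lemma ordered_partitions_iff:
  "P \<in> ordered_partitions A D m \<longleftrightarrow>
     (\<forall>xs\<in>P. distinct xs \<and> xs \<noteq> [] \<and> card (set xs \<inter> D) \<le> 1) \<and>
     (\<forall>xs\<in>P. \<forall>ys\<in>P. xs \<noteq> ys \<longrightarrow> set xs \<inter> set ys = {}) \<and>
     \<Union> (set ` P) = A \<and> card P = m"
proof (cases "\<forall>xs\<in>P. xs \<noteq> []")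
  case True
  then have "inj_on set P \<and> disjoint (set ` P) \<longleftrightarrow>
      (\<forall>xs\<in>P. \<forall>ys\<in>P. xs \<noteq> ys \<longrightarrow> set xs \<inter> set ys = {})"
    unfolding inj_on_def disjoint_def by (auto 0 4)
  moreover have "{} \<notin> set ` P"
    using True by auto
  moreover have "(\<forall>xs\<in>P. distinct xs \<and> xs \<noteq> [] \<and> card (set xs \<inter> D) \<le> 1) \<longleftrightarrow>
      (\<forall>xs\<in>P. distinct xs) \<and> (\<forall>xs\<in>P. card (set xs \<inter> D) \<le> 1)"
    using True by blast
  ultimately show ?thesis
    unfolding ordered_partitions_def partition_on_def mem_Collect_eq by argo
next
  case False
  then show ?thesis
    by (auto simp: ordered_partitions_def partition_on_def)
qed

lemma ordered_partitionsD:
  assumes "P \<in> ordered_partitions A D m"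
  shows "xs \<in> P \<Longrightarrow> distinct xs" "xs \<in> P \<Longrightarrow> xs \<noteq> []" "xs \<in> P \<Longrightarrow> card (set xs \<inter> D) \<le> 1"
    "xs \<in> P \<Longrightarrow> ys \<in> P \<Longrightarrow> x \<in> set xs \<Longrightarrow> x \<in> set ys \<Longrightarrow> xs = ys"
    "\<Union> (set ` P) = A" "card P = m" "xs \<in> P \<Longrightarrow> set xs \<subseteq> A"
  using assms unfolding ordered_partitions_iff by blast+

lemma finite_ordered_partitions:
  assumes "finite A"
  shows "finite (ordered_partitions A D m)"
proof (rule finite_subset)
  show "ordered_partitions A D m \<subseteq> Pow {xs. set xs \<subseteq> A \<and> distinct xs}"
    using ordered_partitionsD(1,7) by blast
  show "finite (Pow {xs. set xs \<subseteq> A \<and> distinct xs})"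
    using finite_subset_distinct[OF assms] by simp
qed

text \<open>Finiteness is derived from \<open>A\<close>, since \<open>card P = m\<close> alone does
  not give it when \<open>m = 0\<close>.\<close>

lemma finite_ordered_partition:
  assumes "finite A" "P \<in> ordered_partitions A D m"
  shows "finite P"
  using finite_subset[OF _ finite_subset_distinct[OF assms(1)]] ordered_partitionsD(1,7)[OF assms(2)]
  by blast

text \<open>Serves both for adding a block (\<open>R = P\<close>) and for exchanging one
  (\<open>R\<close> is \<open>P\<close> without a block). Ground set and number of blocks stay
  unevaluated, to be computed at each use.\<close>

lemma insert_ordered_partitionsI:
  assumes "P \<in> ordered_partitions B D l" "R \<subseteq> P"
    and "distinct xs" "xs \<noteq> []" "card (set xs \<inter> D) \<le> 1"
    and "\<And>ys. ys \<in> R \<Longrightarrow> set xs \<inter> set ys = {}"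
  shows "insert xs R \<in> ordered_partitions (set xs \<union> \<Union> (set ` R)) D (card (insert xs R))"
proof -
  have "\<forall>ys\<in>insert xs R. distinct ys \<and> ys \<noteq> [] \<and> card (set ys \<inter> D) \<le> 1"
    using ordered_partitionsD(1-3)[OF assms(1)] assms(2-5) by blast
  moreover have "set ys \<inter> set zs = {}" if "ys \<in> insert xs R" "zs \<in> insert xs R" "ys \<noteq> zs" for ys zs
    using that ordered_partitionsD(4)[OF assms(1), of ys zs] assms(2) assms(6)[of ys] assms(6)[of zs] by auto
  ultimately show ?thesis
    unfolding ordered_partitions_iff by simp
qed

text \<open>If all elements are distinguished, every block has exactly one element. This is the case
  \<open>n = 0\<close> of the r-Lah numbers.\<close>

lemma ordered_partitions_self:
  assumes "finite A"
  shows "ordered_partitions A A m = (if m = card A then {(\<lambda>x. [x]) ` A} else {})"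
proof -
  have eq: "P = (\<lambda>x. [x]) ` A" if P: "P \<in> ordered_partitions A A m" for P
  proof -
    have single: "\<exists>x\<in>A. xs = [x]" if "xs \<in> P" for xs
    proof -
      have "set xs \<inter> A = set xs" "distinct xs" "xs \<noteq> []"
        using ordered_partitionsD[OF P] that by blast+
      then have "length xs \<le> 1"
        using ordered_partitionsD(3)[OF P that] by (simp add: distinct_card)
      then show ?thesis
        using \<open>xs \<noteq> []\<close> \<open>set xs \<inter> A = set xs\<close> by (cases xs) auto
    qed
    moreover have "[x] \<in> P" if x: "x \<in> A" for x
    proof -
      obtain xs where "xs \<in> P" "x \<in> set xs"
        using x ordered_partitionsD(5)[OF P] by blast
      with single show ?thesis by fastforce
    qed
    ultimately show ?thesis by blast
  qed
  have card: "card ((\<lambda>x. [x]) ` A) = card A"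
    by (rule card_image) (simp add: inj_on_def)
  have "(\<lambda>x. [x]) ` A \<in> ordered_partitions A A (card A)"
    unfolding ordered_partitions_iff by (auto simp: card)
  moreover have "m = card A" if "P \<in> ordered_partitions A A m" for P
    using eq[OF that] ordered_partitionsD(6)[OF that] card by simp
  ultimately have "P \<in> ordered_partitions A A m \<longleftrightarrow> m = card A \<and> P = (\<lambda>x. [x]) ` A" for P
    using eq by metis
  then show ?thesis
    by (simp add: set_eq_iff)
qed

text \<open>Pigeonhole principle: the blocks cover \<open>D\<close>, and each contains at most one
  element of it.\<close>

lemma ordered_partitions_empty:
  assumes "finite A" "D \<subseteq> A" "m < card D"
  shows "ordered_partitions A D m = {}"
proof (rule ccontr)
  assume "ordered_partitions A D m \<noteq> {}"
  then obtain P where P: "P \<in> ordered_partitions A D m" by blast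
  have "D = (\<Union>xs\<in>P. set xs \<inter> D)"
    using ordered_partitionsD(5)[OF P] assms(2) by blast
  then have "card D \<le> (\<Sum>xs\<in>P. card (set xs \<inter> D))"
    using card_UN_le[OF finite_ordered_partition[OF assms(1) P]] by metis
  also have "\<dots> \<le> (\<Sum>xs\<in>P. 1)"
    using ordered_partitionsD(3)[OF P] by (intro sum_mono) blast
  finally show False
    using ordered_partitionsD(6)[OF P] assms(3) by simp
qed

section \<open>Positions at which a new element can be inserted\<close>

lemma card_splits: "card {(us, vs). us @ vs = xs} = Suc (length xs)"
proof -
  have "{(us, vs). us @ vs = xs} = (\<lambda>i. (take i xs, drop i xs)) ` {..length xs}"
  proof -
    have "(us, vs) \<in> (\<lambda>i. (take i (us @ vs), drop i (us @ vs))) ` {..length (us @ vs)}" for us vs :: "'a list"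
      by (rule image_eqI[of _ _ "length us"]) auto
    then show ?thesis by auto
  qed
  moreover have "inj_on (\<lambda>i. (take i xs, drop i xs)) {..length xs}"
    by (rule inj_onI) (metis atMost_iff length_take min.absorb2 prod.inject)
  ultimately show ?thesis by (simp add: card_image)
qed

text \<open>A block of length \<open>l\<close> has \<open>l + 1\<close> insertion positions. The
  lengths add up to \<open>card A\<close>, and the extra ones contribute one per block, hence
  \<open>m\<close>.\<close>

lemma card_insertion_points:
  assumes "finite A" "P \<in> ordered_partitions A D m"
  shows "finite {(us, vs). us @ vs \<in> P}" "card {(us, vs). us @ vs \<in> P} = card A + m"
proof -
  note P = ordered_partitionsD[OF assms(2)] and fin = finite_ordered_partition[OF assms]
  have eq: "{(us, vs). us @ vs \<in> P} = (\<Union>xs\<in>P. {(us, vs). us @ vs = xs})"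
    by auto
  \<comment> \<open>An infinite set would have cardinality 0, whereas \<open>card_splits\<close>
    gives a successor.\<close>
  have fin_splits: "finite {(us, vs). us @ vs = xs}" for xs :: "'a list"
    using card_splits[of xs] card.infinite by force
  show "finite {(us, vs). us @ vs \<in> P}"
    unfolding eq using fin fin_splits by blast
  have "card {(us, vs). us @ vs \<in> P} = (\<Sum>xs\<in>P. Suc (length xs))"
    unfolding eq by (subst card_UN_disjoint) (use fin fin_splits in \<open>auto simp: card_splits\<close>)
  also have "\<dots> = (\<Sum>xs\<in>P. card (set xs)) + card P"
    using P(1) by (simp add: sum_Suc distinct_card)
  also have "(\<Sum>xs\<in>P. card (set xs)) = card (\<Union> (set ` P))"
    by (rule card_UN_disjoint[symmetric]) (use fin P(4) in auto)
  finally show "card {(us, vs). us @ vs \<in> P} = card A + m"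
    using P(5,6) by simp
qed

section \<open>Deleting one element that is not distinguished\<close>

text \<open>Adding and deleting the block \<open>[a]\<close> are mutually inverse, because no
  partition of \<open>A\<close> contains \<open>[a]\<close>.\<close>

lemma card_ordered_partitions_singleton:
  assumes "finite A" "a \<notin> A" "a \<notin> D"
  shows "card {P \<in> ordered_partitions (insert a A) D (Suc m). [a] \<in> P} = card (ordered_partitions A D m)"
proof (rule bij_betw_same_card[symmetric], rule bij_betw_imageI)
  have new: "[a] \<notin> Q" if "Q \<in> ordered_partitions A D m" for Q
    using ordered_partitionsD(7)[OF that, of "[a]"] assms(2) by auto
  show "inj_on (insert [a]) (ordered_partitions A D m)"
    using new by (intro inj_onI) (metis insert_ident)
  show "insert [a] ` ordered_partitions A D m = {P \<in> ordered_partitions (insert a A) D (Suc m). [a] \<in> P}"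
  proof (intro equalityI subsetI)
    fix P assume "P \<in> insert [a] ` ordered_partitions A D m"
    then obtain Q where Q: "Q \<in> ordered_partitions A D m" and "P = insert [a] Q" by blast
    note QD = ordered_partitionsD[OF Q]
    have "set [a] \<inter> set xs = {}" if "xs \<in> Q" for xs
      using QD(7)[OF that] assms(2) by auto
    moreover have "card (insert [a] Q) = Suc m"
      using QD(6) new[OF Q] finite_ordered_partition[OF assms(1) Q] by simp
    moreover have "insert a A = set [a] \<union> \<Union> (set ` Q)"
      using QD(5) by simp
    ultimately have "insert [a] Q \<in> ordered_partitions (insert a A) D (Suc m)"
      using insert_ordered_partitionsI[OF Q subset_refl, of "[a]"] assms(3) by simp
    with \<open>P = insert [a] Q\<close>
    show "P \<in> {P \<in> ordered_partitions (insert a A) D (Suc m). [a] \<in> P}" by blast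
  next
    fix P assume "P \<in> {P \<in> ordered_partitions (insert a A) D (Suc m). [a] \<in> P}"
    then have P: "P \<in> ordered_partitions (insert a A) D (Suc m)" and a: "[a] \<in> P" by auto
    note PD = ordered_partitionsD[OF P]
    have "a \<notin> set xs" if "xs \<in> P - {[a]}" for xs
      using PD(4)[OF a, of xs a] that by auto
    then have "\<Union> (set ` (P - {[a]})) = A"
      using PD(5) a assms(2) by fastforce
    moreover have "card (P - {[a]}) = m"
      using PD(6) a finite_ordered_partition[OF _ P] assms(1) by simp
    ultimately have "P - {[a]} \<in> ordered_partitions A D m"
      unfolding ordered_partitions_iff using PD(1-4) by blast
    then show "P \<in> insert [a] ` ordered_partitions A D m"
      using a by (intro image_eqI[of _ _ "P - {[a]}"]) auto
  qed
qed

text \<open>Each such partition arises from exactly one partition of \<open>A\<close> and one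
  insertion point in it: \<open>a\<close> is put between the two halves of a block. The factor is
  the number of insertion points.\<close>

lemma card_ordered_partitions_non_singleton:
  assumes "finite A" "a \<notin> A" "a \<notin> D"
  shows "card {P \<in> ordered_partitions (insert a A) D m. [a] \<notin> P} =
    (card A + m) * card (ordered_partitions A D m)"
proof -
  define S where "S = (SIGMA Q:ordered_partitions A D m. {(us, vs). us @ vs \<in> Q})"
  define ins where "ins = (\<lambda>(Q, us, vs). insert (us @ a # vs) (Q - {us @ vs}))"
  have notin: "a \<notin> set xs" if "Q \<in> ordered_partitions A D m" "xs \<in> Q" for Q xs
    using ordered_partitionsD(7)[OF that] assms(2) by blast
  have "inj_on ins S"
  proof (rule inj_onI, clarsimp simp: S_def ins_def)
    fix Q us vs Q' us' vs'
    assume Q: "Q \<in> ordered_partitions A D m" "us @ vs \<in> Q"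
      and Q': "Q' \<in> ordered_partitions A D m" "us' @ vs' \<in> Q'"
      and eq: "insert (us @ a # vs) (Q - {us @ vs}) = insert (us' @ a # vs') (Q' - {us' @ vs'})"
    \<comment> \<open>The list containing \<open>a\<close> is new on either side of
      \<open>eq\<close>, so the two new lists must coincide. As \<open>a\<close> occurs only once in
      it, the halves coincide too.\<close>
    have "us @ a # vs \<notin> Q'" "us @ a # vs \<notin> Q" "us' @ a # vs' \<notin> Q'"
      using notin[OF Q'(1), of "us @ a # vs"] notin[OF Q(1), of "us @ a # vs"]
        notin[OF Q'(1), of "us' @ a # vs'"] by auto
    then have list_eq: "us @ a # vs = us' @ a # vs'"
      using eq by blast
    moreover have "a \<notin> set us" "a \<notin> set vs"
      using notin[OF Q] by auto
    ultimately have "us = us'" "vs = vs'"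
      by (simp_all add: append_Cons_eq_iff)
    moreover have "Q = Q'"
    proof -
      have "Q - {us @ vs} = Q' - {us @ vs}"
        using eq list_eq \<open>us @ a # vs \<notin> Q\<close> \<open>us' @ a # vs' \<notin> Q'\<close> \<open>us = us'\<close> \<open>vs = vs'\<close>
        by (metis DiffD1 insert_ident)
      then show ?thesis
        using Q(2) Q'(2) \<open>us = us'\<close> \<open>vs = vs'\<close> by (metis insert_Diff)
    qed
    ultimately show "Q = Q' \<and> us = us' \<and> vs = vs'" by blast
  qed
  moreover have "ins ` S = {P \<in> ordered_partitions (insert a A) D m. [a] \<notin> P}"
  proof (intro equalityI subsetI)
    fix P assume "P \<in> ins ` S"
    then obtain Q us vs where Q: "Q \<in> ordered_partitions A D m" and mem: "us @ vs \<in> Q"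
      and P: "P = insert (us @ a # vs) (Q - {us @ vs})"
      by (auto simp: S_def ins_def)
    note QD = ordered_partitionsD[OF Q]
    have "us @ a # vs \<notin> Q" "[a] \<notin> Q"
      using notin[OF Q, of "us @ a # vs"] notin[OF Q, of "[a]"] by auto
    have "card P = m"
      using QD(6) finite_ordered_partition[OF assms(1) Q] mem \<open>us @ a # vs \<notin> Q\<close>
      by (simp add: P card.remove[symmetric] card_Suc_Diff1 del: card_Diff_insert)
    moreover have "set (us @ a # vs) \<union> \<Union> (set ` (Q - {us @ vs})) = insert a A"
    proof -
      have "set (us @ a # vs) \<union> \<Union> (set ` (Q - {us @ vs})) =
          insert a (set (us @ vs) \<union> \<Union> (set ` (Q - {us @ vs})))"
        by auto
      also have "set (us @ vs) \<union> \<Union> (set ` (Q - {us @ vs})) = \<Union> (set ` Q)"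
        using mem by blast
      finally show ?thesis using QD(5) by simp
    qed
    moreover have "set (us @ a # vs) \<inter> set xs = {}" if "xs \<in> Q - {us @ vs}" for xs
      using QD(4)[OF mem, of xs] notin[OF Q, of xs] that by auto
    moreover have "distinct (us @ a # vs)"
      using QD(1)[OF mem] notin[OF Q mem] by auto
    moreover have "card (set (us @ a # vs) \<inter> D) \<le> 1"
      using QD(3)[OF mem] assms(3) by simp
    ultimately have "P \<in> ordered_partitions (insert a A) D m"
      using insert_ordered_partitionsI[OF Q, of "Q - {us @ vs}" "us @ a # vs"]
      unfolding P by (metis Diff_subset append_is_Nil_conv list.distinct(1))
    moreover have "[a] \<notin> P"
      using QD(2)[OF mem] \<open>[a] \<notin> Q\<close> by (auto simp: P Cons_eq_append_conv)
    ultimately show "P \<in> {P \<in> ordered_partitions (insert a A) D m. [a] \<notin> P}" by blast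
  next
    fix P assume "P \<in> {P \<in> ordered_partitions (insert a A) D m. [a] \<notin> P}"
    then have P: "P \<in> ordered_partitions (insert a A) D m" and a: "[a] \<notin> P" by auto
    note PD = ordered_partitionsD[OF P]
    obtain ys where ys: "ys \<in> P" "a \<in> set ys"
      using PD(5) by blast
    then obtain us vs where split: "ys = us @ a # vs"
      by (meson split_list)
    define Q where "Q = insert (us @ vs) (P - {ys})"
    have dist: "distinct (us @ vs)" "a \<notin> set (us @ vs)"
      using PD(1)[OF ys(1)] split by auto
    \<comment> \<open>This is where \<open>[a] \<notin> P\<close> enters: deleting \<open>a\<close>
      leaves a non-empty block.\<close>
    have nonempty: "us @ vs \<noteq> []"
      using ys(1) a split by auto
    have disj: "set ys \<inter> set xs = {}" if "xs \<in> P - {ys}" for xs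
      using PD(4)[OF ys(1), of xs] that by auto
    have sub: "set (us @ vs) \<subseteq> set ys"
      using split by auto
    \<comment> \<open>The shortened block is non-empty and disjoint from all other blocks, hence
      differs from them. So the number of blocks is preserved.\<close>
    have "us @ vs \<notin> P - {ys}"
      using disj[of "us @ vs"] nonempty sub by (metis inf.absorb2 set_empty)
    moreover have "finite P"
      using finite_ordered_partition[OF _ P] assms(1) by simp
    ultimately have "card Q = m"
      using PD(6) ys(1) by (simp add: Q_def card_Suc_Diff1 del: card_Diff_insert)
    moreover have "set (us @ vs) \<union> \<Union> (set ` (P - {ys})) = A" (is "?U = A")
    proof -
      have "insert a ?U = set ys \<union> \<Union> (set ` (P - {ys}))"
        by (auto simp: split)
      also have "\<dots> = insert a A"
        using PD(5) ys(1) by blast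
      finally have "insert a ?U = insert a A" .
      moreover have "a \<notin> ?U"
        using disj ys(2) dist(2) by auto
      ultimately show ?thesis
        using assms(2) by (simp add: insert_ident)
    qed
    moreover have "set (us @ vs) \<inter> set xs = {}" if "xs \<in> P - {ys}" for xs
      using disj[OF that] sub by blast
    moreover have "card (set (us @ vs) \<inter> D) \<le> 1"
      using PD(3)[OF ys(1)] assms(3) split by simp
    ultimately have "Q \<in> ordered_partitions A D m"
      using insert_ordered_partitionsI[OF P, of "P - {ys}" "us @ vs"] dist(1) nonempty
      unfolding Q_def by (metis Diff_subset)
    then have "(Q, us, vs) \<in> S"
      by (simp add: S_def) (simp add: Q_def)
    moreover have "P = ins (Q, us, vs)"
      using ys(1) \<open>us @ vs \<notin> P - {ys}\<close> split by (auto simp: ins_def Q_def)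
    ultimately show "P \<in> ins ` S"
      by blast
  qed
  ultimately have "card {P \<in> ordered_partitions (insert a A) D m. [a] \<notin> P} = card S"
    by (metis card_image)
  also have "\<dots> = (\<Sum>Q\<in>ordered_partitions A D m. card {(us, vs). us @ vs \<in> Q})"
    unfolding S_def using finite_ordered_partitions[OF assms(1)] card_insertion_points(1)[OF assms(1)]
    by (intro card_SigmaI) auto
  also have "\<dots> = (card A + m) * card (ordered_partitions A D m)"
    using card_insertion_points(2)[OF assms(1)] by simp
  finally show ?thesis .
qed

text \<open>The partitions with block \<open>[a]\<close> are left uncounted, because
  \<open>card_ordered_partitions_singleton\<close> evaluates them only when the number of blocks is
  a successor.\<close>

lemma card_ordered_partitions_insert:
  assumes "finite A" "a \<notin> A" "a \<notin> D"
  shows "card (ordered_partitions (insert a A) D m) =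
    card {P \<in> ordered_partitions (insert a A) D m. [a] \<in> P} +
    (card A + m) * card (ordered_partitions A D m)"
proof -
  have "finite (ordered_partitions (insert a A) D m)"
    using assms(1) by (simp add: finite_ordered_partitions)
  then have "card (ordered_partitions (insert a A) D m) =
      card {P \<in> ordered_partitions (insert a A) D m. [a] \<in> P} +
      card {P \<in> ordered_partitions (insert a A) D m. [a] \<notin> P}"
    by (subst card_Un_disjoint[symmetric]) (auto intro: arg_cong[where f = card])
  then show ?thesis
    using card_ordered_partitions_non_singleton[OF assms] by simp
qed

section \<open>The recurrence of the r-Lah numbers\<close>

lemma r_Lah_0: "r_Lah r 0 k = (if k = 0 then 1 else 0)"
  by (simp add: r_Lah_def ordered_partitions_self)

text \<open>With only \<open>r\<close> blocks the new element cannot be alone: for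
  \<open>r = 0\<close> there is no block at all, and otherwise \<open>r - 1\<close> blocks would
  remain for \<open>r\<close> distinguished elements. The factor is
  \<open>(n + r) + r\<close>.\<close>

lemma r_Lah_Suc_0: "r_Lah r (Suc n) 0 = (n + 2 * r) * r_Lah r n 0"
proof -
  let ?P = "{P \<in> ordered_partitions (insert (n + r) {..<n + r}) {..<r} r. [n + r] \<in> P}"
  have "card ?P = 0"
  proof (cases r)
    case 0
    have "P = {}" if "P \<in> ordered_partitions (insert n {..<n}) {} 0" for P
      using finite_ordered_partition[OF _ that] ordered_partitionsD(6)[OF that] by simp
    then have "?P = {}" using 0 by auto
    then show ?thesis by (simp only: card.empty)
  next
    case (Suc r')
    have "ordered_partitions {..<n + r} {..<r} r' = {}"
      by (rule ordered_partitions_empty) (auto simp: Suc)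
    then show ?thesis
      using card_ordered_partitions_singleton[of "{..<n + r}" "n + r" "{..<r}" r'] Suc by simp
  qed
  then show ?thesis
    using card_ordered_partitions_insert[of "{..<n + r}" "n + r" "{..<r}" r]
    by (simp add: r_Lah_def lessThan_Suc mult_2 add.assoc)
qed

text \<open>The element \<open>n + r\<close> is the one deleted. Insertion into
  \<open>Suc k + r\<close> blocks on \<open>n + r\<close> elements gives the factor
  \<open>(n + r) + (Suc k + r)\<close>.\<close>

lemma r_Lah_Suc_Suc:
  "r_Lah r (Suc n) (Suc k) = r_Lah r n k + (n + Suc k + 2 * r) * r_Lah r n (Suc k)"
  using card_ordered_partitions_insert[of "{..<n + r}" "n + r" "{..<r}" "Suc (k + r)"]
    card_ordered_partitions_singleton[of "{..<n + r}" "n + r" "{..<r}" "k + r"]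
  by (simp add: r_Lah_def lessThan_Suc mult_2 ac_simps)

lemma r_Lah_eq_0: "n < k \<Longrightarrow> r_Lah r n k = 0"
proof (induction n arbitrary: k)
  case 0
  then show ?case by (simp add: r_Lah_0)
next
  case (Suc n)
  then show ?case by (cases k) (auto simp: r_Lah_Suc_Suc)
qed

section \<open>Rising factorials in the basis of falling factorials\<close>

lemma pochhammer_eq_sum_r_Lah:
  fixes x :: real
  shows "pochhammer (x + 2 * real r) n = (\<Sum>k\<le>n. real (r_Lah r n k) * (\<Prod>i<k. x - real i))"
proof (induction n)
  case 0
  then show ?case by (simp add: r_Lah_0)
next
  case (Suc n)
  let ?f = "\<lambda>k. \<Prod>i<k. x - real i"
  let ?L = "\<lambda>n k. real (r_Lah r n k)"
  have "pochhammer (x + 2 * real r) (Suc n) = (\<Sum>k\<le>n. ?L n k * ?f k) * (x + 2 * real r + real n)"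
    by (simp add: pochhammer_Suc Suc)
  \<comment> \<open>The factor is split as \<open>(x - k) + (n + k + 2 * r)\<close>, and
    \<open>x - k\<close> extends \<open>?f k\<close> to \<open>?f (Suc k)\<close>.\<close>
  also have "\<dots> = (\<Sum>k\<le>n. ?L n k * ?f (Suc k)) + (\<Sum>k\<le>n. real (n + k + 2 * r) * ?L n k * ?f k)"
    unfolding sum_distrib_right sum.distrib[symmetric] by (intro sum.cong) (auto simp: algebra_simps)
  \<comment> \<open>The added summand vanishes by \<open>r_Lah_eq_0\<close>. After splitting off
    \<open>k = 0\<close>, both sums run over the same \<open>?f (Suc k)\<close> with
    \<open>k \<le> n\<close>.\<close>
  also have "(\<Sum>k\<le>n. real (n + k + 2 * r) * ?L n k * ?f k) =
      (\<Sum>k\<le>Suc n. real (n + k + 2 * r) * ?L n k * ?f k)"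
    by (simp add: r_Lah_eq_0)
  also have "\<dots> = real (n + 2 * r) * ?L n 0 +
      (\<Sum>k\<le>n. real (n + Suc k + 2 * r) * ?L n (Suc k) * ?f (Suc k))"
    by (subst sum.atMost_Suc_shift) simp
  also have "(\<Sum>k\<le>n. ?L n k * ?f (Suc k)) + \<dots> = ?L (Suc n) 0 + (\<Sum>k\<le>n. ?L (Suc n) (Suc k) * ?f (Suc k))"
    unfolding r_Lah_Suc_0 r_Lah_Suc_Suc of_nat_add of_nat_mult distrib_right sum.distrib
    by (simp only: ac_simps)
  also have "\<dots> = (\<Sum>k\<le>Suc n. ?L (Suc n) k * ?f k)"
    by (subst sum.atMost_Suc_shift) simp
  finally show ?case .
qed

section \<open>Factorial moments of the Poisson distribution\<close>

text \<open>The terms with \<open>i < k\<close> vanish. In the others the falling factorial cancels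
  against \<open>fact i\<close>, which leaves \<alpha>^k times the exponential series.\<close>

lemma sums_poisson_factorial_moment:
  "(\<lambda>i. exp (- \<alpha>) * \<alpha> ^ i / fact i * (\<Prod>j<k. real i - real j)) sums (\<alpha> ^ k :: real)"
proof -
  let ?g = "\<lambda>i. exp (- \<alpha>) * \<alpha> ^ i / fact i * (\<Prod>j<k. real i - real j)"
  have falling: "(\<Prod>j<k. real (i + k) - real j) = fact (i + k) / fact i" for i
  proof -
    have "(\<Prod>j<k. real (i + k) - real j) * fact i = fact (i + k)"
    proof (induction k)
      case (Suc k)
      \<comment> \<open>The factor \<open>j = 0\<close> is split off; the index shift lowers the
        remaining factors to those for \<open>k\<close>.\<close>
      have "(\<Prod>j<Suc k. real (i + Suc k) - real j) = real (i + Suc k) * (\<Prod>j<k. real (i + k) - real j)"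
        by (subst prod.lessThan_Suc_shift) simp
      then show ?case using Suc by (simp add: mult.assoc)
    qed simp
    then show ?thesis by (simp add: field_simps)
  qed
  have "(\<lambda>i. exp (- \<alpha>) * \<alpha> ^ k * (inverse (fact i) * \<alpha> ^ i)) sums (exp (- \<alpha>) * \<alpha> ^ k * exp \<alpha>)"
    using exp_converges[of \<alpha>] by (intro sums_mult) (simp add: scaleR_conv_of_real)
  also have "exp (- \<alpha>) * \<alpha> ^ k * exp \<alpha> = \<alpha> ^ k"
    by (simp add: exp_minus)
  also have "(\<lambda>i. exp (- \<alpha>) * \<alpha> ^ k * (inverse (fact i) * \<alpha> ^ i)) = (\<lambda>i. ?g (i + k))"
    unfolding falling by (simp add: fun_eq_iff field_simps power_add)
  finally have "(\<lambda>i. ?g (i + k)) sums \<alpha> ^ k" .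
  moreover have "(\<Sum>i<k. ?g i) = 0"
    by (intro sum.neutral) auto
  ultimately show ?thesis
    using sums_iff_shift[of ?g k "\<alpha> ^ k"] by simp
qed

text \<open>Falling factorials are non-negative at natural numbers, so the convergent series
  converges absolutely, as integrability demands.\<close>

lemma has_bochner_integral_poisson_factorial_moment:
  assumes "\<alpha> > 0"
  shows "has_bochner_integral (measure_pmf (poisson_pmf \<alpha>)) (\<lambda>i. \<Prod>j<k. real i - real j) (\<alpha> ^ k)"
proof -
  let ?f = "\<lambda>i. \<Prod>j<k. real i - real j"
  have nonneg: "0 \<le> ?f i" for i
  proof (cases "i < k")
    case True
    then have "?f i = 0" by (intro prod_zero) auto
    then show ?thesis by linarith
  qed (auto intro: prod_nonneg)
  have sums: "(\<lambda>i. pmf (poisson_pmf \<alpha>) i * ?f i) sums \<alpha> ^ k"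
    using sums_poisson_factorial_moment[of \<alpha> k] assms by (simp add: poisson_pmf.rep_eq mult_ac)
  have "has_bochner_integral (count_space UNIV) (\<lambda>i. pmf (poisson_pmf \<alpha>) i * ?f i) (\<alpha> ^ k)"
    unfolding has_bochner_integral_iff
    using sums nonneg integral_count_space_nat[of "\<lambda>i. pmf (poisson_pmf \<alpha>) i * ?f i"]
    by (auto simp: integrable_count_space_nat_iff sums_iff abs_mult)
  then show ?thesis
    unfolding measure_pmf_eq_density by (intro has_bochner_integral_density) auto
qed

text \<open>\<open>X\<close> is real-valued and known only through its point probabilities at
  natural numbers. These sum to 1, so \<open>X\<close> is almost surely natural and its law is
  \<open>poisson_pmf\<close>.\<close>

lemma (in prob_space) has_bochner_integral_poisson:
  fixes X :: "'a \<Rightarrow> real" and f :: "real \<Rightarrow> real"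
  assumes "\<alpha> > 0" and X [measurable]: "X \<in> borel_measurable M"
    and poisson: "\<And>i::nat. prob {\<omega> \<in> space M. X \<omega> = real i} = exp (- \<alpha>) * \<alpha> ^ i / fact i"
    and f [measurable]: "f \<in> borel_measurable borel"
    and int: "has_bochner_integral (measure_pmf (poisson_pmf \<alpha>)) (\<lambda>i. f (real i)) c"
  shows "has_bochner_integral M (\<lambda>\<omega>. f (X \<omega>)) c"
proof -
  \<comment> \<open>A measurable variable with values in the natural numbers, equal to
    \<open>X\<close> wherever \<open>X\<close> is a natural number.\<close>
  define N where "N = (\<lambda>\<omega>. nat \<lfloor>X \<omega>\<rfloor>)"
  have N [measurable]: "N \<in> measurable M (count_space UNIV)"
    unfolding N_def by measurable
  have "(\<lambda>i. prob {\<omega> \<in> space M. X \<omega> = real i}) sums prob (\<Union>i. {\<omega> \<in> space M. X \<omega> = real i})"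
    by (rule finite_measure_UNION) (auto simp: disjoint_family_on_def)
  \<comment> \<open>For \<open>k = 0\<close> the product is empty, so the zeroth factorial moment is
    the total mass.\<close>
  moreover have "(\<lambda>i. prob {\<omega> \<in> space M. X \<omega> = real i}) sums 1"
    using sums_poisson_factorial_moment[of \<alpha> 0] by (simp add: poisson)
  ultimately have "prob (\<Union>i. {\<omega> \<in> space M. X \<omega> = real i}) = 1"
    by (rule sums_unique2)
  then have "AE \<omega> in M. \<omega> \<in> (\<Union>i::nat. {\<omega> \<in> space M. X \<omega> = real i})"
    by (subst (asm) prob_eq_1) auto
  then have X_eq: "AE \<omega> in M. X \<omega> = real (N \<omega>)"
    by (rule AE_mp) (auto simp: N_def)
  have "distr M (count_space UNIV) N = measure_pmf (poisson_pmf \<alpha>)"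
  proof (rule measure_eqI_countable[where A = UNIV])
    fix i :: nat
    have "prob (N -` {i} \<inter> space M) = prob {\<omega> \<in> space M. X \<omega> = real i}"
      using X_eq by (intro measure_eq_AE) (auto elim!: AE_mp)
    then show "emeasure (distr M (count_space UNIV) N) {i} = emeasure (measure_pmf (poisson_pmf \<alpha>)) {i}"
      using assms(1) by (simp add: emeasure_distr emeasure_eq_measure poisson emeasure_pmf_single mult_ac)
  qed auto
  with int have "has_bochner_integral (distr M (count_space UNIV) N) (\<lambda>i. f (real i)) c"
    by simp
  then have "has_bochner_integral M (\<lambda>\<omega>. f (real (N \<omega>))) c"
    by (simp add: has_bochner_integral_iff integrable_distr_eq integral_distr)
  moreover have "AE \<omega> in M. f (real (N \<omega>)) = f (X \<omega>)"
    using X_eq by (auto elim!: AE_mp)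
  ultimately show ?thesis
    using has_bochner_integral_cong_AE[of "\<lambda>\<omega>. f (real (N \<omega>))" M "\<lambda>\<omega>. f (X \<omega>)" c] by simp
qed

theorem theorem11:
  fixes M :: "'a measure" and X :: "'a \<Rightarrow> real" and \<alpha> :: real and r n :: nat
  assumes "\<alpha> > 0"
    and "prob_space M"
    and "X \<in> borel_measurable M"
    and "\<And>i::nat. measure M {\<omega> \<in> space M. X \<omega> = real i} = exp (- \<alpha>) * \<alpha> ^ i / fact i"
  shows "integrable M (\<lambda>\<omega>. pochhammer (X \<omega> + 2 * real r) n) \<and>
    prob_space.expectation M (\<lambda>\<omega>. pochhammer (X \<omega> + 2 * real r) n) = r_Lah_Bell r n \<alpha>"
proof -
  interpret prob_space M by fact
  have "has_bochner_integral M (\<lambda>\<omega>. \<Prod>i<k. X \<omega> - real i) (\<alpha> ^ k)" for k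
    using assms has_bochner_integral_poisson_factorial_moment[OF assms(1)]
    by (intro has_bochner_integral_poisson[where f = "\<lambda>x. \<Prod>i<k. x - real i"]) auto
  \<comment> \<open>\<open>has_bochner_integral\<close> carries integrability together with the
    value, so linearity yields both parts of the conclusion.\<close>
  then have "has_bochner_integral M (\<lambda>\<omega>. \<Sum>k\<le>n. real (r_Lah r n k) * (\<Prod>i<k. X \<omega> - real i))
      (\<Sum>k\<le>n. real (r_Lah r n k) * \<alpha> ^ k)"
    by (intro has_bochner_integral_sum has_bochner_integral_mult_right)
  then show ?thesis
    unfolding pochhammer_eq_sum_r_Lah[symmetric] has_bochner_integral_iff
    by (simp add: r_Lah_Bell_def atLeast0AtMost)
qed

end
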